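(* Let $X=\mathrm{Sp}_{2n}(2)$ with $n\ge2$, and let $\Gamma$ be an $X$-strongly incidence-transitive code in $J(\mathcal{Q}^\epsilon,k)$, where $2\le k\le|\mathcal{Q}^\epsilon|-2$, such that for $\Delta\in\Gamma$ the stabiliser $X_\Delta$ is irreducible on $V$. Then $X_\Delta$ is not contained in a maximal $\mathcal C_8$-subgroup of $X$, i.e. $X_\Delta\not\le X_\psi$ for every $\psi\in\mathcal{Q}$.
   Context: $V=\mathbb{F}_2^{2n}$ with symplectic form $B$, $X=\mathrm{Sp}_{2n}(2)$ its isometry group. $\mathcal{Q}$ is the set of quadratic forms $\phi:V\to\mathbb{F}_2$ with $\phi(x+y)+\phi(x)+\phi(y)=B(x,y)$ and $\mathcal{Q}^\epsilon$ those of type $\epsilon\in\{+,-\}$, $|\mathcal{Q}^\epsilon|=2^{n-1}(2^n+\epsilon)$; $X$ acts by $\phi^g(x)=\phi(xg^{-1})$. The maximal $\mathcal C_8$-subgroups of $X$ are the stabilisers $X_\psi\cong\mathrm{O}^{\pm}_{2n}(2)$ of forms $\psi\in\mathcal{Q}$. A code in $J(\mathcal{Q}^\epsilon,k)$ is a nonempty set of $k$-subsets of $\mathcal{Q}^\epsilon$; $X$-strongly incidence-transitive means $X$ preserves $\Gamma$, is transitive on it, and each $X_\Delta$ is transitive on $\Delta\times(\mathcal{Q}^\epsilon\setminus\Delta)$. Irreducible: no nonzero proper invariant subspace. *)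

theory Defs
  imports "HOL-Analysis.Cartesian_Space" "HOL-Library.Z2"
begin

definition bilinear_form :: "(bit ^ 'm \<Rightarrow> bit ^ 'm \<Rightarrow> bit) \<Rightarrow> bool" where
  "bilinear_form B \<longleftrightarrow>
     (\<forall>x. Vector_Spaces.linear (*s) (*) (\<lambda>y. B x y)) \<and>
     (\<forall>y. Vector_Spaces.linear (*s) (*) (\<lambda>x. B x y))"

definition symplectic_form :: "(bit ^ 'm \<Rightarrow> bit ^ 'm \<Rightarrow> bit) \<Rightarrow> bool" where
  "symplectic_form B \<longleftrightarrow>
     bilinear_form B \<and> (\<forall>x. B x x = 0) \<and> (\<forall>x. (\<forall>y. B x y = 0) \<longrightarrow> x = 0)"

text \<open>Maps are written as functions, so \<open>g x\<close> stands for \<open>xg\<close>.\<close>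

definition Sp :: "(bit ^ 'm \<Rightarrow> bit ^ 'm \<Rightarrow> bit) \<Rightarrow> (bit ^ 'm \<Rightarrow> bit ^ 'm) set" where
  "Sp B = {g. Vector_Spaces.linear (*s) (*s) g \<and> bij g \<and> (\<forall>x y. B (g x) (g y) = B x y)}"

definition polar_form :: "(bit ^ 'm \<Rightarrow> bit) \<Rightarrow> bit ^ 'm \<Rightarrow> bit ^ 'm \<Rightarrow> bit" where
  "polar_form \<phi> x y = \<phi> (x + y) + \<phi> x + \<phi> y"

definition quadratic_form :: "(bit ^ 'm \<Rightarrow> bit) \<Rightarrow> bool" where
  "quadratic_form \<phi> \<longleftrightarrow>
     (\<forall>c x. \<phi> (c *s x) = c\<^sup>2 * \<phi> x) \<and> bilinear_form (polar_form \<phi>)"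

definition quad_forms :: "(bit ^ 'm \<Rightarrow> bit ^ 'm \<Rightarrow> bit) \<Rightarrow> (bit ^ 'm \<Rightarrow> bit) set" where
  "quad_forms B = {\<phi>. quadratic_form \<phi> \<and> (\<forall>x y. polar_form \<phi> x y = B x y)}"

definition totally_singular :: "(bit ^ 'm \<Rightarrow> bit) \<Rightarrow> (bit ^ 'm) set \<Rightarrow> bool" where
  "totally_singular \<phi> W \<longleftrightarrow> vec.subspace W \<and> (\<forall>w\<in>W. \<phi> w = 0)"

definition witt_index :: "(bit ^ 'm \<Rightarrow> bit) \<Rightarrow> nat" where
  "witt_index \<phi> = Max {vec.dim W | W. totally_singular \<phi> W}"

datatype form_type = Plus_type | Minus_type

text \<open>In dimension \<open>2n\<close>, a form has type \<open>+\<close> if its Witt index is \<open>n\<close>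
  and type \<open>-\<close> if its Witt index is \<open>n - 1\<close>.\<close>

fun has_type :: "(bit ^ 'm \<Rightarrow> bit) \<Rightarrow> form_type \<Rightarrow> bool" where
  "has_type (\<phi> :: bit ^ 'm \<Rightarrow> bit) Plus_type \<longleftrightarrow> 2 * witt_index \<phi> = CARD('m)"
| "has_type (\<phi> :: bit ^ 'm \<Rightarrow> bit) Minus_type \<longleftrightarrow> 2 * (witt_index \<phi> + 1) = CARD('m)"

definition quad_forms_of_type ::
    "(bit ^ 'm \<Rightarrow> bit ^ 'm \<Rightarrow> bit) \<Rightarrow> form_type \<Rightarrow> (bit ^ 'm \<Rightarrow> bit) set" where
  "quad_forms_of_type B \<epsilon> = {\<phi> \<in> quad_forms B. has_type \<phi> \<epsilon>}"

definition form_act :: "(bit ^ 'm \<Rightarrow> bit ^ 'm) \<Rightarrow> (bit ^ 'm \<Rightarrow> bit) \<Rightarrow> (bit ^ 'm \<Rightarrow> bit)" where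
  "form_act g \<phi> = (\<lambda>x. \<phi> (inv g x))"

definition form_stabiliser ::
    "(bit ^ 'm \<Rightarrow> bit ^ 'm) set \<Rightarrow> (bit ^ 'm \<Rightarrow> bit) \<Rightarrow> (bit ^ 'm \<Rightarrow> bit ^ 'm) set" where
  "form_stabiliser G \<psi> = {g \<in> G. form_act g \<psi> = \<psi>}"

definition setwise_stabiliser ::
    "(bit ^ 'm \<Rightarrow> bit ^ 'm) set \<Rightarrow> (bit ^ 'm \<Rightarrow> bit) set \<Rightarrow> (bit ^ 'm \<Rightarrow> bit ^ 'm) set" where
  "setwise_stabiliser G \<Delta> = {g \<in> G. form_act g ` \<Delta> = \<Delta>}"

definition irreducible_on_space :: "(bit ^ 'm \<Rightarrow> bit ^ 'm) set \<Rightarrow> bool" where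
  "irreducible_on_space G \<longleftrightarrow>
     (\<forall>W. vec.subspace W \<and> (\<forall>g\<in>G. g ` W \<subseteq> W) \<longrightarrow> W = {0} \<or> W = UNIV)"

definition transitive_via :: "('g \<Rightarrow> 'a \<Rightarrow> 'a) \<Rightarrow> 'g set \<Rightarrow> 'a set \<Rightarrow> bool" where
  "transitive_via act G S \<longleftrightarrow> (\<forall>x\<in>S. \<forall>y\<in>S. \<exists>g\<in>G. act g x = y)"

definition johnson_code :: "'a set \<Rightarrow> nat \<Rightarrow> 'a set set \<Rightarrow> bool" where
  "johnson_code \<Omega> k \<Gamma> \<longleftrightarrow> \<Gamma> \<noteq> {} \<and> (\<forall>\<Delta>\<in>\<Gamma>. \<Delta> \<subseteq> \<Omega> \<and> card \<Delta> = k)"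

definition strongly_incidence_transitive ::
    "(bit ^ 'm \<Rightarrow> bit ^ 'm) set \<Rightarrow> (bit ^ 'm \<Rightarrow> bit) set \<Rightarrow> (bit ^ 'm \<Rightarrow> bit) set set \<Rightarrow> bool" where
  "strongly_incidence_transitive G \<Omega> \<Gamma> \<longleftrightarrow>
     (\<forall>g\<in>G. (\<lambda>\<Delta>. form_act g ` \<Delta>) ` \<Gamma> = \<Gamma>) \<and>
     transitive_via (\<lambda>g \<Delta>. form_act g ` \<Delta>) G \<Gamma> \<and>
     (\<forall>\<Delta>\<in>\<Gamma>. transitive_via (\<lambda>g. map_prod (form_act g) (form_act g))
        (setwise_stabiliser G \<Delta>) (\<Delta> \<times> (\<Omega> - \<Delta>)))"

end

theory Submission
  imports Defs
begin

text \<open>Let \<open>U\<close> be the set of vectors on which all forms in \<open>\<Delta>\<close> agree. Forms with the same polar form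
  differ by a linear functional, so \<open>U\<close> is an \<open>X\<^sub>\<Delta>\<close>-invariant subspace; it is proper
  because \<open>\<Delta>\<close> has more than one element, so \<open>U = 0\<close> by irreducibility. Suppose that \<open>X\<^sub>\<Delta>\<close> fixes
  \<open>\<psi>\<close>. If \<open>\<theta>\<close> is a form outside \<open>\<Delta>\<close>, then \<open>\<theta> - \<psi> = B(a, \<cdot>)\<close> for a unique vector \<open>a\<close>, which is
  therefore fixed by the stabiliser of \<open>\<theta>\<close> in \<open>X\<^sub>\<Delta>\<close>. As that group is transitive on \<open>\<Delta>\<close>, all forms
  in \<open>\<Delta>\<close> take the same value at \<open>a\<close>, that is, \<open>a \<in> U = 0\<close> and \<open>\<theta> = \<psi>\<close>. So at most one form lies
  outside \<open>\<Delta>\<close>, contradicting \<open>k \<le> \<bar>\<Q>\<^sup>\<epsilon>\<bar> - 2\<close>.\<close>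

lemma nondegenerate_bij_betw_linear_functionals:
  fixes B :: "'a::field ^ 'n \<Rightarrow> 'a ^ 'n \<Rightarrow> 'a"
  assumes left: "\<And>y. Vector_Spaces.linear (*s) (*) (\<lambda>x. B x y)"
    and right: "\<And>x. Vector_Spaces.linear (*s) (*) (B x)"
    and nondegenerate: "\<And>x. (\<And>y. B x y = 0) \<Longrightarrow> x = 0"
  shows "bij_betw B UNIV {f. Vector_Spaces.linear (*s) (*) f}"
proof (rule bij_betw_imageI)
  interpret functional: vector_space_pair "(*s) :: 'a \<Rightarrow> 'a ^ 'n \<Rightarrow> 'a ^ 'n" "(*)"
    using left by (simp add: Vector_Spaces.linear_def vector_space_pair_def)
  define T :: "'a ^ 'n \<Rightarrow> 'a ^ 'n" where "T x = (\<chi> i. B x (axis i 1))" for x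
  interpret T: Vector_Spaces.linear "(*s)" "(*s)" T
    using functional.linear_add[OF left] functional.linear_scale[OF left]
    by unfold_locales (auto simp: T_def vec_eq_iff)
  have eq_B_if_eq_on_axis: "f = B x"
    if "Vector_Spaces.linear (*s) (*) f" and "\<And>i. f (axis i 1) = B x (axis i 1)" for f x
  proof
    show "f y = B x y" for y
      by (rule functional.linear_eq_on[OF that(1) right, where B = cart_basis])
        (simp, auto simp: cart_basis_def that(2))
  qed
  have "B x = B x'" if "T x = T x'" for x x'
    using that by (intro eq_B_if_eq_on_axis right) (simp add: T_def vec_eq_iff)
  moreover show "inj B"
  proof (rule injI)
    fix x x' assume "B x = B x'"
    then have "B (x - x') y = 0" for y
      by (simp add: functional.linear_diff[OF left])
    then have "x - x' = 0" by (rule nondegenerate)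
    then show "x = x'" by simp
  qed
  ultimately have "inj T" by (meson injI injD)
  then have "surj T"
    using vec.linear_injective_imp_surjective T.linear_axioms by blast
  show "range B = {f. Vector_Spaces.linear (*s) (*) f}"
  proof (intro equalityI subsetI)
    fix f :: "'a ^ 'n \<Rightarrow> 'a" assume "f \<in> {f. Vector_Spaces.linear (*s) (*) f}"
    then have f: "Vector_Spaces.linear (*s) (*) f" by simp
    obtain x where "T x = (\<chi> i. f (axis i 1))" using \<open>surj T\<close> by (metis surj_def)
    then have "f = B x"
      by (intro eq_B_if_eq_on_axis f) (simp add: T_def vec_eq_iff)
    then show "f \<in> range B" by simp
  qed (use right in auto)
qed

lemma symplectic_form_bij_betw_linear_functionals:
  assumes "symplectic_form B"
  shows "bij_betw B UNIV {f. Vector_Spaces.linear (*s) (*) f}"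
  using assms unfolding symplectic_form_def bilinear_form_def
  by (intro nondegenerate_bij_betw_linear_functionals) blast+

definition equalizer :: "('a \<Rightarrow> 'b) set \<Rightarrow> 'a set" where
  "equalizer F = {x. \<forall>f\<in>F. \<forall>g\<in>F. f x = g x}"

lemma equalizerI: "(\<And>f g. f \<in> F \<Longrightarrow> g \<in> F \<Longrightarrow> f x = g x) \<Longrightarrow> x \<in> equalizer F"
  unfolding equalizer_def by blast

lemma equalizerD: "x \<in> equalizer F \<Longrightarrow> f \<in> F \<Longrightarrow> g \<in> F \<Longrightarrow> f x = g x"
  unfolding equalizer_def by blast

lemma subspace_equalizer:
  fixes F :: "('a::field ^ 'n \<Rightarrow> 'a) set"
  assumes "\<And>f g. f \<in> F \<Longrightarrow> g \<in> F \<Longrightarrow> Vector_Spaces.linear (*s) (*) (\<lambda>x. f x - g x)"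
  shows "vec.subspace (equalizer F)"
proof -
  have "vec.subspace (\<Inter>f\<in>F. \<Inter>g\<in>F. {x. f x - g x = 0})"
    using assms
    by (intro vec.subspace_Int module_hom.subspace_kernel) (simp add: linear_iff_module_hom)
  moreover have "equalizer F = (\<Inter>f\<in>F. \<Inter>g\<in>F. {x. f x - g x = 0})"
    by (auto simp: equalizer_def)
  ultimately show ?thesis by simp
qed

lemma card_le_1_if_equalizer_eq_UNIV:
  assumes "equalizer F = UNIV"
  shows "card F \<le> 1"
proof -
  have "f = g" if "f \<in> F" "g \<in> F" for f g
    using that assms by (intro ext equalizerD[of _ F]) simp_all
  then show ?thesis
    by (cases "finite F") (auto simp: card_le_Suc0_iff_eq)
qed

lemma form_act_apply [simp]: "inj g \<Longrightarrow> form_act g \<phi> (g x) = \<phi> x"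
  by (simp add: form_act_def)

lemma setwise_stabiliser_image_equalizer_subset:
  assumes "inj g" and "g \<in> setwise_stabiliser G \<Delta>"
  shows "g ` equalizer \<Delta> \<subseteq> equalizer \<Delta>"
proof (intro image_subsetI equalizerI)
  fix x \<phi> \<phi>' assume x: "x \<in> equalizer \<Delta>" and "\<phi> \<in> \<Delta>" "\<phi>' \<in> \<Delta>"
  then obtain \<alpha> \<alpha>' where "\<alpha> \<in> \<Delta>" "\<alpha>' \<in> \<Delta>" "\<phi> = form_act g \<alpha>" "\<phi>' = form_act g \<alpha>'"
    using assms(2) unfolding setwise_stabiliser_def by blast
  with equalizerD[OF x] assms(1) show "\<phi> (g x) = \<phi>' (g x)"
    by (metis form_act_apply)
qed

lemma fixed_vector_in_equalizer:
  assumes "transitive_via form_act H \<Delta>"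
    and "\<And>g. g \<in> H \<Longrightarrow> inj g" and "\<And>g. g \<in> H \<Longrightarrow> g a = a"
  shows "a \<in> equalizer \<Delta>"
proof (rule equalizerI)
  fix \<phi> \<phi>' assume "\<phi> \<in> \<Delta>" "\<phi>' \<in> \<Delta>"
  then obtain g where g: "g \<in> H" "form_act g \<phi> = \<phi>'"
    using assms(1) unfolding transitive_via_def by blast
  have "\<phi> a = form_act g \<phi> (g a)" using assms(2)[OF g(1)] by simp
  then show "\<phi> a = \<phi>' a" by (simp only: g(2) assms(3)[OF g(1)])
qed

lemma transitive_via_point_stabiliser:
  assumes "transitive_via (\<lambda>g. map_prod (act g) (act' g)) G (S \<times> T)" and "t \<in> T"
  shows "transitive_via act {g \<in> G. act' g t = t} S"
  using assms unfolding transitive_via_def by fastforce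

lemma quad_forms_add:
  assumes "\<phi> \<in> quad_forms B"
  shows "\<phi> (x + y) = \<phi> x + \<phi> y + B x y"
proof -
  have "\<phi> (x + y) + \<phi> x + \<phi> y = B x y"
    using assms by (simp only: quad_forms_def polar_form_def mem_Collect_eq)
  then show ?thesis
    by (cases "\<phi> (x + y)"; cases "\<phi> x"; cases "\<phi> y") auto
qed

lemma linear_diff_quad_forms:
  assumes "\<phi> \<in> quad_forms B" and "\<psi> \<in> quad_forms B"
  shows "Vector_Spaces.linear (*s) (*) (\<lambda>x. \<phi> x - \<psi> x)"
proof
  show "\<phi> (x + y) - \<psi> (x + y) = (\<phi> x - \<psi> x) + (\<phi> y - \<psi> y)" for x y
    by (simp only: quad_forms_add[OF assms(1)] quad_forms_add[OF assms(2)] algebra_simps)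
  have "\<phi> (c *s x) = c\<^sup>2 * \<phi> x" "\<psi> (c *s x) = c\<^sup>2 * \<psi> x" "c\<^sup>2 = c" for c x
    using assms by (auto simp: quad_forms_def quadratic_form_def)
  then show "\<phi> (c *s x) - \<psi> (c *s x) = c * (\<phi> x - \<psi> x)" for c x
    by (simp only: right_diff_distrib)
qed

lemma equalizer_eq_zero_if_irreducible:
  assumes "\<Delta> \<subseteq> quad_forms B" and "card \<Delta> \<ge> 2"
    and "irreducible_on_space (setwise_stabiliser (Sp B) \<Delta>)"
  shows "equalizer \<Delta> = {0}"
proof -
  have "vec.subspace (equalizer \<Delta>)"
    using assms(1) by (intro subspace_equalizer linear_diff_quad_forms) auto
  moreover have "g ` equalizer \<Delta> \<subseteq> equalizer \<Delta>" if "g \<in> setwise_stabiliser (Sp B) \<Delta>" for g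
  proof (rule setwise_stabiliser_image_equalizer_subset[OF _ that])
    show "inj g" using that by (simp add: setwise_stabiliser_def Sp_def bij_is_inj)
  qed
  ultimately have "equalizer \<Delta> = {0} \<or> equalizer \<Delta> = UNIV"
    using assms(3) by (simp add: irreducible_on_space_def)
  moreover have "equalizer \<Delta> \<noteq> UNIV"
    using card_le_1_if_equalizer_eq_UNIV assms(2) by fastforce
  ultimately show ?thesis by blast
qed

lemma Sp_fixes_difference_vector:
  assumes "symplectic_form B" and "g \<in> Sp B"
    and "form_act g \<psi> = \<psi>" and "form_act g \<theta> = \<theta>"
    and "(\<lambda>x. \<theta> x - \<psi> x) = B a"
  shows "g a = a"
proof -
  have "bij g" and isometry: "B (g x) (g y) = B x y" for x y
    using assms(2) by (auto simp: Sp_def)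
  have "B (g a) = B a"
  proof
    fix y
    obtain x where x: "y = g x" using \<open>bij g\<close> by (metis bij_pointE)
    have "B (g a) y = B a x" by (simp only: x isometry)
    also have "\<dots> = \<theta> x - \<psi> x" using assms(5) by metis
    also have "\<dots> = form_act g \<theta> y - form_act g \<psi> y"
      using \<open>bij g\<close> by (simp only: x bij_is_inj form_act_apply)
    also have "\<dots> = B a y" using assms(3-5) by metis
    finally show "B (g a) y = B a y" .
  qed
  moreover have "inj B"
    using symplectic_form_bij_betw_linear_functionals[OF assms(1)] by (rule bij_betw_imp_inj_on)
  ultimately show ?thesis by (simp only: inj_eq)
qed

lemma stabilised_forms_eq_if_equalizer_eq_zero:
  assumes B: "symplectic_form B" and \<psi>: "\<psi> \<in> quad_forms B" and \<theta>: "\<theta> \<in> quad_forms B"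
    and stabilised: "H \<subseteq> form_stabiliser (Sp B) \<psi>"
    and transitive: "transitive_via form_act (form_stabiliser H \<theta>) \<Delta>"
    and "equalizer \<Delta> = {0}"
  shows "\<theta> = \<psi>"
proof -
  obtain a where a: "(\<lambda>x. \<theta> x - \<psi> x) = B a"
    using symplectic_form_bij_betw_linear_functionals[OF B] linear_diff_quad_forms[OF \<theta> \<psi>]
    by (auto simp: bij_betw_def)
  have "a \<in> equalizer \<Delta>"
  proof (rule fixed_vector_in_equalizer[OF transitive])
    fix g assume "g \<in> form_stabiliser H \<theta>"
    then have g: "g \<in> Sp B" "form_act g \<psi> = \<psi>" "form_act g \<theta> = \<theta>"
      using stabilised by (auto simp: form_stabiliser_def)
    then show "inj g" by (simp add: Sp_def bij_is_inj)
    show "g a = a" using Sp_fixes_difference_vector[OF B g a] .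
  qed
  then have "a = 0" using assms(6) by simp
  moreover have "B 0 x = 0" for x
    using B unfolding symplectic_form_def bilinear_form_def
    by (metis linear_iff_module_hom module_hom.zero)
  ultimately have "\<theta> x - \<psi> x = 0" for x using a by metis
  then show ?thesis by (intro ext) (simp only: right_minus_eq)
qed

theorem theorem6p14:
  fixes B :: "bit ^ 'm \<Rightarrow> bit ^ 'm \<Rightarrow> bit"
    and n k :: nat
    and \<epsilon> :: form_type
    and \<Gamma> :: "(bit ^ 'm \<Rightarrow> bit) set set"
    and \<Delta> :: "(bit ^ 'm \<Rightarrow> bit) set"
  assumes "CARD('m) = 2 * n" and "n \<ge> 2"
    and "symplectic_form B"
    and "2 \<le> k" and "k + 2 \<le> card (quad_forms_of_type B \<epsilon>)"
    and "johnson_code (quad_forms_of_type B \<epsilon>) k \<Gamma>"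
    and "strongly_incidence_transitive (Sp B) (quad_forms_of_type B \<epsilon>) \<Gamma>"
    and "\<Delta> \<in> \<Gamma>"
    and "irreducible_on_space (setwise_stabiliser (Sp B) \<Delta>)"
  shows "\<forall>\<psi> \<in> quad_forms B.
    \<not> setwise_stabiliser (Sp B) \<Delta> \<subseteq> form_stabiliser (Sp B) \<psi>"
proof (intro ballI notI)
  let ?\<Omega> = "quad_forms_of_type B \<epsilon>" and ?X\<^sub>\<Delta> = "setwise_stabiliser (Sp B) \<Delta>"
  fix \<psi> assume \<psi>: "\<psi> \<in> quad_forms B" and stabilised: "?X\<^sub>\<Delta> \<subseteq> form_stabiliser (Sp B) \<psi>"
  have \<Delta>: "\<Delta> \<subseteq> ?\<Omega>" "card \<Delta> = k" and \<Omega>: "?\<Omega> \<subseteq> quad_forms B"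
    using assms(6,8) by (auto simp: johnson_code_def quad_forms_of_type_def)
  have "transitive_via (\<lambda>g. map_prod (form_act g) (form_act g)) ?X\<^sub>\<Delta> (\<Delta> \<times> (?\<Omega> - \<Delta>))"
    using assms(7,8) by (simp add: strongly_incidence_transitive_def)
  then have "transitive_via form_act (form_stabiliser ?X\<^sub>\<Delta> \<theta>) \<Delta>" if "\<theta> \<in> ?\<Omega> - \<Delta>" for \<theta>
    using that unfolding form_stabiliser_def by (rule transitive_via_point_stabiliser)
  moreover have "equalizer \<Delta> = {0}"
    using \<Delta> \<Omega> assms(4,9) by (intro equalizer_eq_zero_if_irreducible) auto
  ultimately have "?\<Omega> \<subseteq> insert \<psi> \<Delta>"
    using stabilised_forms_eq_if_equalizer_eq_zero[OF assms(3) \<psi> _ stabilised] \<Omega> by blast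
  moreover have "finite \<Delta>"
    using \<Delta>(2) assms(4) by (intro card_ge_0_finite) simp
  ultimately have "card ?\<Omega> \<le> card (insert \<psi> \<Delta>)"
    by (intro card_mono) auto
  also have "\<dots> \<le> Suc k"
    using \<open>finite \<Delta>\<close> \<Delta>(2) by (simp add: card_insert_if)
  finally show False using assms(5) by simp
qed

end
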